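(* Let $\bar\alpha=(\alpha_1,\dots,\alpha_n)$ be pairwise distinct nonzero complex numbers, $\bar\mu=(\mu^{(1)},\dots,\mu^{(n)})$ nonzero partitions, $M'=\sum_i(\mu^{(i)})'_1$, $M=\sum_i\mu^{(i)}_1$, and $z\in\mathbb{C}$. (1) Let $W\in\mathcal{E}(\bar\alpha,\bar\mu)$, let $(e_1,\dots,e_{M'})$ be the sequence of discrete exponents of $W$ at $z$, and define a partition $\lambda$ by $e_i=M'+\lambda_i-i$ for $i=1,\dots,M'$ and $\lambda_{M'+1}=0$. Let $(\check e_1,\dots,\check e_M)$ be the sequence of $T_-$-discrete exponents of $Q(W)$ at $z-1$, and define a partition $\eta$ by $\check e_a=M+\eta_a-a$ for $a=1,\dots,M$ and $\eta_{M+1}=0$. Then $\eta=\lambda'$. (2) Let $W_-\in\mathcal{E}(\bar\alpha^{-1},\bar\mu')$, let $(e_1,\dots,e_M)$ be the sequence of $T_-$-discrete exponents of $W_-$ at $z-1$, and define a partition $\lambda$ by $e_i=M+\lambda_i-i$ for $i=1,\dots,M$ and $\lambda_{M+1}=0$. Let $(\check e_1,\dots,\check e_{M'})$ be the sequence of discrete exponents of $Q_-(W_-)$ at $z$, and define a partition $\eta$ by $\check e_a=M'+\eta_a-a$ for $a=1,\dots,M'$ and $\eta_{M'+1}=0$. Then $\eta=\lambda'$.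
   Context: Fix a branch of $\ln$; $\alpha^{x}=e^{x\ln\alpha}$, $\alpha^{-x}=e^{-x\ln\alpha}$. $(Tf)(x)=f(x+1)$, $T_-=T^{-1}$. A partition is an infinite nonincreasing sequence of nonnegative integers stabilizing at zero; $\mu'$ is its conjugate, $\mu'_i=\#\{j:\mu_j\ge i\}$. $\mathcal{W}(g_1,\dots,g_m)=\det\big((T^{j-1}g_i)_{i,j=1}^m\big)$, $\mathcal{W}_-(g_1,\dots,g_m)=\det\big((T_-^{j-1}g_i)_{i,j=1}^m\big)$. $\mathcal{E}(\bar\alpha,\bar\mu)$: spaces of functions with a basis $\{\alpha_i^xq_{ij}(x):1\le i\le n,\ 1\le j\le(\mu^{(i)})'_1\}$, $q_{ij}$ polynomials with $\deg q_{ij}=(\mu^{(i)})'_1+\mu^{(i)}_j-j$. $\mathcal{E}(\bar\alpha^{-1},\bar\mu')$: spaces with a basis $\{\alpha_i^{-x}q_{ij}(x):1\le i\le n,\ 1\le j\le\mu^{(i)}_1\}$, $q_{ij}$ polynomials with $\deg q_{ij}=\mu^{(i)}_1+(\mu^{(i)})'_j-j$. Put $p_i=\mu^{(i)}_1+(\mu^{(i)})'_1$. $Q(W)$ for $W\in\mathcal{E}(\bar\alpha,\bar\mu)$: let $\widehat W$ be the span of $\alpha_i^xx^p$, $1\le i\le n$, $0\le p\le p_i-1$. Choose a basis $f_1,\dots,f_{M'}$ of $W$, complete it by $h_1,\dots,h_M$ to a basis of $\widehat W$; $Q(W)$ is the span of $T\left(\frac{\mathcal{W}(f_1,\dots,f_{M'},h_1,\dots,h_{a-1},h_{a+1},\dots,h_M)}{\mathcal{W}(f_1,\dots,f_{M'},h_1,\dots,h_M)}\right)$,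 $a=1,\dots,M$. It belongs to $\mathcal{E}(\bar\alpha^{-1},\bar\mu')$. $Q_-(W_-)$ for $W_-\in\mathcal{E}(\bar\alpha^{-1},\bar\mu')$: let $\widehat W_-$ be the span of $\alpha_i^{-x}x^p$, $1\le i\le n$, $0\le p\le p_i-1$. Choose a basis $f_1,\dots,f_M$ of $W_-$, complete it by $h_1,\dots,h_{M'}$ to a basis of $\widehat W_-$; $Q_-(W_-)$ is the span of $T_-\left(\frac{\mathcal{W}_-(f_1,\dots,f_M,h_1,\dots,h_{a-1},h_{a+1},\dots,h_{M'})}{\mathcal{W}_-(f_1,\dots,f_M,h_1,\dots,h_{M'})}\right)$, $a=1,\dots,M'$. It belongs to $\mathcal{E}(\bar\alpha,\bar\mu)$. Discrete exponents of an $N$-dimensional space $W$ of this kind at $z$: the unique integers $e_1>\dots>e_N$ such that $W$ has a basis $\psi_1,\dots,\psi_N$ with $(T^j\psi_i)(z)=0$ for $0\le j\le e_i-1$ and $(T^{e_i}\psi_i)(z)\ne0$. $T_-$-discrete exponents: the same with $T$ replaced by $T_-$. *)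

theory Defs
  imports
    Complex_Main
    "HOL-Library.Function_Algebras"
    "HOL-Computational_Algebra.Polynomial"
    "Jordan_Normal_Form.Determinant"
begin

text \<open>
  All families that are indexed from 1 in the usual mathematical notation are indexed from 0 here:
  \<open>\<mu> j\<close> is the part $\mu_{j+1}$ of a partition, \<open>conj_partition \<mu> i\<close> is $\mu'_{i+1}$,
  and \<open>es ! i\<close> is the exponent $e_{i+1}$.
\<close>

definition is_partition :: "(nat \<Rightarrow> nat) \<Rightarrow> bool" where
  "is_partition \<mu> \<longleftrightarrow> antimono \<mu> \<and> (\<exists>k. \<forall>j\<ge>k. \<mu> j = 0)"

definition conj_partition :: "(nat \<Rightarrow> nat) \<Rightarrow> nat \<Rightarrow> nat" where
  "conj_partition \<mu> i = card {j. \<mu> j \<ge> i + 1}"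

type_synonym cfun = "complex \<Rightarrow> complex"

definition cscale :: "complex \<Rightarrow> cfun \<Rightarrow> cfun" where
  "cscale c f = (\<lambda>x. c * f x)"

interpretation cfun: vector_space cscale
  by unfold_locales (auto simp: cscale_def fun_eq_iff algebra_simps)

text \<open>An indexed family (without repetitions) that is a basis of the space \<open>V\<close>.\<close>

definition is_basis :: "'i set \<Rightarrow> ('i \<Rightarrow> cfun) \<Rightarrow> cfun set \<Rightarrow> bool" where
  "is_basis I b V \<longleftrightarrow>
     inj_on b I \<and> cfun.independent (b ` I) \<and> cfun.span (b ` I) = V"

abbreviation is_basis_list :: "cfun list \<Rightarrow> cfun set \<Rightarrow> bool" where
  "is_basis_list bs \<equiv> is_basis {..<length bs} (\<lambda>i. bs ! i)"

definition shift :: "cfun \<Rightarrow> cfun" where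
  "shift f = (\<lambda>x. f (x + 1))"

definition shift_inv :: "cfun \<Rightarrow> cfun" where
  "shift_inv f = (\<lambda>x. f (x - 1))"

text \<open>The discrete Wronskian, for \<open>S\<close> either \<open>shift\<close> or \<open>shift_inv\<close>.\<close>

definition discrete_wronskian :: "(cfun \<Rightarrow> cfun) \<Rightarrow> cfun list \<Rightarrow> cfun" where
  "discrete_wronskian S gs =
     (\<lambda>x. det (mat (length gs) (length gs) (\<lambda>(i, j). (S ^^ j) (gs ! i) x)))"

text \<open>
  Spaces of quasi-exponentials with a basis $e^{\beta_i x} q_{ij}(x)$, where $1 \le i \le n$,
  $1 \le j \le r_i$ and $\deg q_{ij} = r_i + d_{ij} - j$. The number \<open>\<beta> i\<close> is the value of
  $\pm\ln\alpha_i$; since the chosen branch need not satisfy $\ln(\alpha^{-1}) = -\ln\alpha$,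
  the function $\alpha^{-x}$ must not be read as $(\alpha^{-1})^x$.
\<close>

definition quasi_exp_spaces ::
    "nat \<Rightarrow> (nat \<Rightarrow> complex) \<Rightarrow> (nat \<Rightarrow> nat) \<Rightarrow> (nat \<Rightarrow> nat \<Rightarrow> nat) \<Rightarrow> cfun set set" where
  "quasi_exp_spaces n \<beta> r d =
     {V. \<exists>q :: nat \<Rightarrow> nat \<Rightarrow> complex poly.
           (\<forall>i<n. \<forall>j<r i. degree (q i j) = r i + d i j - (j + 1)) \<and>
           is_basis (SIGMA i:{..<n}. {..<r i}) (\<lambda>(i, j) x. exp (x * \<beta> i) * poly (q i j) x) V}"

text \<open>
  $\mathcal{E}(\bar\alpha,\bar\mu)$ and $\mathcal{E}(\bar\alpha^{-1},\bar\mu')$; \<open>L\<close> is the branch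
  of the logarithm.
\<close>

definition E_space ::
    "(complex \<Rightarrow> complex) \<Rightarrow> nat \<Rightarrow> (nat \<Rightarrow> complex) \<Rightarrow> (nat \<Rightarrow> nat \<Rightarrow> nat) \<Rightarrow> cfun set set" where
  "E_space L n \<alpha> \<mu> =
     quasi_exp_spaces n (\<lambda>i. L (\<alpha> i)) (\<lambda>i. conj_partition (\<mu> i) 0) \<mu>"

definition E_space_inv ::
    "(complex \<Rightarrow> complex) \<Rightarrow> nat \<Rightarrow> (nat \<Rightarrow> complex) \<Rightarrow> (nat \<Rightarrow> nat \<Rightarrow> nat) \<Rightarrow> cfun set set" where
  "E_space_inv L n \<alpha> \<mu> =
     quasi_exp_spaces n (\<lambda>i. - L (\<alpha> i)) (\<lambda>i. \<mu> i 0) (\<lambda>i. conj_partition (\<mu> i))"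

text \<open>The ambient spaces $\widehat W$ (for $\beta_i = \ln\alpha_i$) and $\widehat W_-$
  (for $\beta_i = -\ln\alpha_i$).\<close>

definition hat_space :: "nat \<Rightarrow> (nat \<Rightarrow> complex) \<Rightarrow> (nat \<Rightarrow> nat \<Rightarrow> nat) \<Rightarrow> cfun set" where
  "hat_space n \<beta> \<mu> =
     cfun.span {(\<lambda>x. exp (x * \<beta> i) * x ^ p) | i p. i < n \<and> p < \<mu> i 0 + conj_partition (\<mu> i) 0}"

text \<open>
  \<open>U\<close> is the space obtained from \<open>V\<close> for some choice of a basis \<open>fs\<close> of \<open>V\<close> and of its completion
  \<open>hs\<close> to a basis of the ambient space. A relation is used, so that a theorem about all such \<open>U\<close>
  covers every choice. The quotient is harmless: the denominator is a nonzero multiple of an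
  exponential function, hence has no zeros.
\<close>

definition is_dual_space :: "(cfun \<Rightarrow> cfun) \<Rightarrow> cfun set \<Rightarrow> cfun set \<Rightarrow> cfun set \<Rightarrow> bool" where
  "is_dual_space S V_hat V U \<longleftrightarrow>
     (\<exists>fs hs. is_basis_list fs V \<and> is_basis_list (fs @ hs) V_hat \<and>
        U = cfun.span
              {S (\<lambda>x. discrete_wronskian S (fs @ take a hs @ drop (Suc a) hs) x /
                      discrete_wronskian S (fs @ hs) x) | a. a < length hs})"

text \<open>\<open>is_Q L n \<alpha> \<mu> W U\<close> says $U = Q(W)$, and \<open>is_Q_inv L n \<alpha> \<mu> W U\<close> says $U = Q_-(W)$.\<close>

definition is_Q ::
    "(complex \<Rightarrow> complex) \<Rightarrow> nat \<Rightarrow> (nat \<Rightarrow> complex) \<Rightarrow> (nat \<Rightarrow> nat \<Rightarrow> nat) \<Rightarrow>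
     cfun set \<Rightarrow> cfun set \<Rightarrow> bool" where
  "is_Q L n \<alpha> \<mu> = is_dual_space shift (hat_space n (\<lambda>i. L (\<alpha> i)) \<mu>)"

definition is_Q_inv ::
    "(complex \<Rightarrow> complex) \<Rightarrow> nat \<Rightarrow> (nat \<Rightarrow> complex) \<Rightarrow> (nat \<Rightarrow> nat \<Rightarrow> nat) \<Rightarrow>
     cfun set \<Rightarrow> cfun set \<Rightarrow> bool" where
  "is_Q_inv L n \<alpha> \<mu> = is_dual_space shift_inv (hat_space n (\<lambda>i. - L (\<alpha> i)) \<mu>)"

text \<open>The \<open>S\<close>-discrete exponents of \<open>V\<close> at \<open>z\<close>, in decreasing order.\<close>

definition discrete_exponents :: "(cfun \<Rightarrow> cfun) \<Rightarrow> cfun set \<Rightarrow> complex \<Rightarrow> nat list" where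
  "discrete_exponents S V z =
     (THE es. sorted_wrt (>) es \<and>
        (\<exists>\<psi>s. is_basis_list \<psi>s V \<and> length \<psi>s = length es \<and>
           (\<forall>i<length es. (\<forall>j<es ! i. (S ^^ j) (\<psi>s ! i) z = 0) \<and>
                           (S ^^ (es ! i)) (\<psi>s ! i) z \<noteq> 0)))"

text \<open>\<open>lam\<close> is the partition with $e_i = N + \lambda_i - i$ for $1 \le i \le N$ and
  $\lambda_{N+1} = 0$.\<close>

definition is_exponent_partition :: "nat \<Rightarrow> nat list \<Rightarrow> (nat \<Rightarrow> nat) \<Rightarrow> bool" where
  "is_exponent_partition N es lam \<longleftrightarrow>
     is_partition lam \<and>
     (\<forall>i<N. int (es ! i) = int N + int (lam i) - int (i + 1)) \<and> lam N = 0"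

end

(*
  Let gs = fs @ hs be a basis of the ambient space, N its length, D_b the Wronskian without gs!b
  and v_b(x) = D_b(x + s) / W(x + s), where s = 1 or s = -1 is the step. Laplace expansion along
  the last column shows that sum_b (+-) gs_b(z + s i) v_b(z - s - s j) vanishes for i + j < N - 1
  and equals 1 for i + j = N - 1. Since V is spanned by the gs_b with b < length fs and its dual
  by the other v_b, coefficient vectors of the two spaces are orthogonal. Back substitution in
  this antitriangular system shows that no exponent e of V and k of the dual satisfy
  e + k = N - 1. Counting dimensions, the exponents of the dual are exactly the N - 1 - c for c not
  an exponent of V, which is the description of the conjugate partition by complementary beads.
*)
theory Submission
  imports Defs
begin

section \<open>Bases of function spaces as indexed families, in terms of coefficients\<close>

section \<open>Finite families of functions\<close>

text \<open>A step \<open>s\<close> as parameter covers \<open>shift\<close> (\<open>s = 1\<close>)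
  and \<open>shift_inv\<close> (\<open>s = - 1\<close>), so each later argument is carried out once
  for both halves.\<close>

definition translate :: "complex \<Rightarrow> cfun \<Rightarrow> cfun" where
  "translate s f = (\<lambda>x. f (x + s))"

lemma shift_eq_translate: "shift = translate 1" "shift_inv = translate (- 1)"
  by (simp_all add: fun_eq_iff shift_def shift_inv_def translate_def)

lemma translate_funpow: "(translate s ^^ j) f x = f (x + s * of_nat j)"
  by (induction j arbitrary: x) (simp_all add: translate_def algebra_simps)

lemma sum_cfun_apply: "(\<Sum>i\<in>I. f i :: cfun) x = (\<Sum>i\<in>I. f i x)"
  by (induction I rule: infinite_finite_induct) (simp_all add: zero_fun_def)

text \<open>Independence of coefficients already rules out repetitions: if \<open>b i = b k\<close>
  with \<open>i \<noteq> k\<close>, the difference of the indicator families of \<open>i\<close> and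
  \<open>k\<close> is a nontrivial relation.\<close>

lemma is_basis_familyI:
  assumes fin: "finite I"
    and indep: "\<And>c. (\<And>x. (\<Sum>i\<in>I. c i * b i x) = 0) \<Longrightarrow> \<forall>i\<in>I. c i = 0"
  shows "is_basis I b (cfun.span (b ` I))"
proof -
  have inj: "inj_on b I"
  proof (rule inj_onI, rule ccontr)
    fix i k assume ik: "i \<in> I" "k \<in> I" "b i = b k" "i \<noteq> k"
    define c :: "_ \<Rightarrow> complex" where "c j = (if j = i then 1 else 0) - (if j = k then 1 else 0)" for j
    have "(\<Sum>j\<in>I. c j * b j x) = 0" for x
    proof -
      have "(\<Sum>j\<in>I. c j * b j x) =
          (\<Sum>j\<in>I. (if j = i then b j x else 0)) - (\<Sum>j\<in>I. (if j = k then b j x else 0))"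
        unfolding sum_subtractf[symmetric] by (rule sum.cong) (auto simp: c_def)
      then show ?thesis using ik fin by simp
    qed
    from indep[OF this] ik have "c i = 0" by blast
    then show False using ik by (simp add: c_def)
  qed
  have "\<not> cfun.dependent (b ` I)"
  proof
    assume "cfun.dependent (b ` I)"
    then obtain u v where u: "v \<in> b ` I" "u v \<noteq> 0" "(\<Sum>v\<in>b ` I. cscale (u v) v) = 0"
      using fin by (auto simp: cfun.dependent_finite)
    have "(\<Sum>i\<in>I. u (b i) * b i x) = 0" for x
      using fun_cong[OF u(3), of x]
      by (simp add: sum.reindex[OF inj] sum_cfun_apply cscale_def)
    from indep[OF this] u show False by blast
  qed
  with inj show ?thesis by (simp add: is_basis_def)
qed

lemma is_basis_family_independent:
  assumes "finite I" "is_basis I b V" "\<And>x. (\<Sum>i\<in>I. c i * b i x) = 0" "i \<in> I"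
  shows "c i = 0"
proof (rule ccontr)
  assume "c i \<noteq> 0"
  have inj: "inj_on b I" and ind: "\<not> cfun.dependent (b ` I)" using assms by (auto simp: is_basis_def)
  define u where "u v = c (the_inv_into I b v)" for v
  have u: "u (b i) = c i" if "i \<in> I" for i
    using that by (simp add: u_def the_inv_into_f_f[OF inj])
  have "(\<Sum>v\<in>b ` I. cscale (u v) v) = 0"
    using assms(3) by (simp add: fun_eq_iff sum.reindex[OF inj] sum_cfun_apply cscale_def u)
  then have "cfun.dependent (b ` I)"
    using assms \<open>c i \<noteq> 0\<close> u by (auto simp: cfun.dependent_finite intro!: exI[of _ u])
  with ind show False by simp
qed

lemma is_basis_expand:
  assumes "finite I" "is_basis I b V" "f \<in> V"
  obtains c where "\<And>x. f x = (\<Sum>i\<in>I. c i * b i x)"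
proof -
  have inj: "inj_on b I" using assms by (auto simp: is_basis_def)
  have "f \<in> cfun.span (b ` I)" using assms by (auto simp: is_basis_def)
  then obtain u where "f = (\<Sum>v\<in>b ` I. cscale (u v) v)"
    using assms(1) by (auto simp: cfun.span_finite)
  then have "f x = (\<Sum>i\<in>I. u (b i) * b i x)" for x
    by (simp add: sum.reindex[OF inj] sum_cfun_apply cscale_def)
  then show ?thesis using that[of "\<lambda>i. u (b i)"] by blast
qed

lemma is_basis_card_eq:
  assumes "is_basis I b V" "is_basis J d V"
  shows "card I = card J"
proof -
  have "cfun.dim V = card I" using assms(1) unfolding is_basis_def
    by (metis card_image cfun.dim_eq_card_independent cfun.dim_span)
  moreover have "cfun.dim V = card J" using assms(2) unfolding is_basis_def
    by (metis card_image cfun.dim_eq_card_independent cfun.dim_span)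
  ultimately show ?thesis by simp
qed

lemma is_basis_subspace: "is_basis I b V \<Longrightarrow> cfun.subspace V"
  unfolding is_basis_def using cfun.subspace_span by blast

lemma is_basis_mem: "is_basis I b V \<Longrightarrow> i \<in> I \<Longrightarrow> b i \<in> V"
  unfolding is_basis_def using cfun.span_base by blast

lemma sum_in_subspace:
  assumes "cfun.subspace V" "\<And>i. i \<in> I \<Longrightarrow> b i \<in> V"
  shows "(\<lambda>x. \<Sum>i\<in>I. c i * b i x) \<in> V"
proof -
  have "(\<lambda>x. \<Sum>i\<in>I. c i * b i x) = (\<Sum>i\<in>I. cscale (c i) (b i))"
    by (simp add: fun_eq_iff sum_cfun_apply cscale_def)
  then show ?thesis using assms by (simp add: cfun.subspace_sum cfun.subspace_scale)
qed

section \<open>Orders of vanishing along an arithmetic progression\<close>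

section \<open>Discrete exponents\<close>

text \<open>The orders are collected over all of \<open>V\<close>, with no basis chosen.\<close>

definition exponent_set :: "complex \<Rightarrow> cfun set \<Rightarrow> complex \<Rightarrow> nat set" where
  "exponent_set s V z =
     {e. \<exists>f\<in>V. (\<forall>j<e. f (z + s * of_nat j) = 0) \<and> f (z + s * of_nat e) \<noteq> 0}"

text \<open>Under this condition every nonzero element of \<open>V\<close> has an order below
  \<open>N\<close>.\<close>

definition determined_by_values :: "nat \<Rightarrow> complex \<Rightarrow> complex \<Rightarrow> cfun set \<Rightarrow> bool" where
  "determined_by_values N s z V \<longleftrightarrow> (\<forall>f\<in>V. (\<forall>j<N. f (z + s * of_nat j) = 0) \<longrightarrow> f = 0)"

text \<open>One function per order gives a triangular system, hence independence; clearing the first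
  nonzero value again and again gives spanning.\<close>

lemma exponent_set_basis:
  assumes sub: "cfun.subspace V"
    and determined: "determined_by_values N s z V"
  shows "exponent_set s V z \<subseteq> {..<N}"
    "\<exists>\<psi>. is_basis (exponent_set s V z) \<psi> V \<and> (\<forall>e\<in>exponent_set s V z. \<psi> e \<in> V \<and>
      (\<forall>j<e. \<psi> e (z + s * of_nat j) = 0) \<and> \<psi> e (z + s * of_nat e) \<noteq> 0)"
proof -
  let ?E = "exponent_set s V z"
  have vanish: "f = 0" if "f \<in> V" "\<forall>j<N. f (z + s * of_nat j) = 0" for f
    using determined that by (auto simp: determined_by_values_def)
  have "\<forall>e\<in>?E. \<exists>f. f \<in> V \<and> (\<forall>j<e. f (z + s * of_nat j) = 0) \<and> f (z + s * of_nat e) \<noteq> 0"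
    unfolding exponent_set_def by blast
  then obtain \<psi> where psi: "\<And>e. e \<in> ?E \<Longrightarrow> \<psi> e \<in> V \<and>
      (\<forall>j<e. \<psi> e (z + s * of_nat j) = 0) \<and> \<psi> e (z + s * of_nat e) \<noteq> 0" by metis
  show E: "?E \<subseteq> {..<N}"
  proof
    fix e assume "e \<in> ?E"
    from psi[OF this] show "e \<in> {..<N}" using vanish[of "\<psi> e"]
      by (metis lessThan_iff linorder_not_le order_less_le_trans zero_fun_apply)
  qed
  then have fin: "finite ?E" using finite_subset by blast
  have "is_basis ?E \<psi> (cfun.span (\<psi> ` ?E))"
  proof (rule is_basis_familyI[OF fin])
    fix c assume c: "\<And>x. (\<Sum>e\<in>?E. c e * \<psi> e x) = 0"
    have "e \<in> ?E \<longrightarrow> c e = 0" for e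
    proof (induction e rule: less_induct)
      case (less e)
      show ?case
      proof
        assume e: "e \<in> ?E"
        \<comment> \<open>At the point of index \<open>e\<close> the functions of larger order
          vanish, and the coefficients of smaller order are zero by induction.\<close>
        have "0 = (\<Sum>k\<in>?E. c k * \<psi> k (z + s * of_nat e))" using c by simp
        also have "\<dots> = (\<Sum>k\<in>{e}. c k * \<psi> k (z + s * of_nat e))"
        proof (rule sum.mono_neutral_right)
          show "\<forall>k\<in>?E - {e}. c k * \<psi> k (z + s * of_nat e) = 0"
          proof
            fix k assume k: "k \<in> ?E - {e}"
            then consider "k < e" | "e < k" by force
            then show "c k * \<psi> k (z + s * of_nat e) = 0"
            proof cases
              case 1 then show ?thesis using less k by simp
            next
              case 2 then show ?thesis using psi[of k] k by simp
            qed
          qed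
        qed (use fin e in auto)
        finally show "c e = 0" using psi[OF e] by simp
      qed
    qed
    then show "\<forall>e\<in>?E. c e = 0" by blast
  qed
  moreover have "cfun.span (\<psi> ` ?E) = V"
  proof
    show "cfun.span (\<psi> ` ?E) \<subseteq> V" using psi sub by (intro cfun.span_minimal) auto
    \<comment> \<open>\<open>k\<close> bounds how many of the \<open>N\<close> values may be
      nonzero, counted from the end: for \<open>k = 0\<close> the function is zero, for
      \<open>k = N\<close> there is no condition.\<close>
    have "f \<in> V \<Longrightarrow> \<forall>j<N - k. f (z + s * of_nat j) = 0 \<Longrightarrow> f \<in> cfun.span (\<psi> ` ?E)" for f k
    proof (induction k arbitrary: f)
      case 0
      then have "f = 0" using vanish by simp
      then show ?case by (metis cfun.span_zero)
    next
      case (Suc k)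
      define e where "e = N - Suc k"
      show ?case
      \<comment> \<open>The bound \<open>k < N\<close> keeps \<open>N - Suc k\<close> from being
        truncated. If the value at \<open>e\<close> is nonzero, then \<open>e\<close> is an order,
        and a multiple of \<open>\<psi> e\<close> removes that value.\<close>
      proof (cases "k < N \<and> f (z + s * of_nat e) \<noteq> 0")
        case False
        have "\<forall>j<N - k. f (z + s * of_nat j) = 0"
        proof (intro allI impI)
          fix j assume "j < N - k"
          then have "j < N - Suc k \<or> (j = e \<and> k < N)" by (auto simp: e_def)
          then show "f (z + s * of_nat j) = 0" using Suc.prems False by auto
        qed
        then show ?thesis using Suc by blast
      next
        case True
        with Suc.prems have e: "e \<in> ?E" unfolding exponent_set_def e_def by blast
        define c where "c = f (z + s * of_nat e) / \<psi> e (z + s * of_nat e)"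
        define g where "g = f - cscale c (\<psi> e)"
        have "g \<in> V" using Suc.prems sub psi[OF e]
          by (simp add: g_def cfun.subspace_diff cfun.subspace_scale)
        moreover have "\<forall>j<N - k. g (z + s * of_nat j) = 0"
        proof (intro allI impI)
          fix j assume "j < N - k"
          then consider "j < e" | "j = e" by (force simp: e_def)
          then show "g (z + s * of_nat j) = 0"
            by cases (use Suc.prems psi[OF e] in \<open>auto simp: g_def cscale_def c_def e_def\<close>)
        qed
        ultimately have "g \<in> cfun.span (\<psi> ` ?E)" by (rule Suc.IH)
        moreover have "cscale c (\<psi> e) \<in> cfun.span (\<psi> ` ?E)"
          using e by (intro cfun.span_scale cfun.span_base) auto
        moreover have "f = g + cscale c (\<psi> e)" by (simp add: g_def)
        ultimately show ?thesis using cfun.span_add by metis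
      qed
    qed
    from this[of _ N] show "V \<subseteq> cfun.span (\<psi> ` ?E)" by auto
  qed
  ultimately have "is_basis ?E \<psi> V" by simp
  with psi show "\<exists>\<psi>. is_basis ?E \<psi> V \<and> (\<forall>e\<in>?E. \<psi> e \<in> V \<and>
      (\<forall>j<e. \<psi> e (z + s * of_nat j) = 0) \<and> \<psi> e (z + s * of_nat e) \<noteq> 0)" by blast
qed

text \<open>The definite description needs uniqueness: the entries of any admissible list are orders
  of elements of \<open>V\<close>, and their number is the dimension of \<open>V\<close>, so they
  exhaust \<open>exponent_set s V z\<close>; strict decrease then fixes the list.\<close>

lemma discrete_exponents_eq:
  assumes sub: "cfun.subspace V"
    and determined: "determined_by_values N s z V"
  shows "discrete_exponents (translate s) V z = rev (sorted_list_of_set (exponent_set s V z))"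
proof -
  let ?E = "exponent_set s V z"
  define es where "es = rev (sorted_list_of_set ?E)"
  note E = exponent_set_basis(1)[OF sub determined]
  obtain \<psi> where bas: "is_basis ?E \<psi> V" and psi: "\<And>e. e \<in> ?E \<Longrightarrow> \<psi> e \<in> V \<and>
      (\<forall>j<e. \<psi> e (z + s * of_nat j) = 0) \<and> \<psi> e (z + s * of_nat e) \<noteq> 0"
    using exponent_set_basis(2)[OF sub determined] by blast
  have fin: "finite ?E" using E finite_subset by blast
  have es: "set es = ?E" "sorted_wrt (>) es" "distinct es"
    using fin strict_sorted_list_of_set[of ?E] by (auto simp: es_def sorted_wrt_rev)
  show ?thesis unfolding discrete_exponents_def es_def[symmetric] translate_funpow
  proof (rule the_equality)
    have bij: "bij_betw (\<lambda>i. es ! i) {..<length es} ?E"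
      using bij_betw_nth[OF es(3)] es(1) by blast
    have "is_basis {..<length (map \<psi> es)} (\<lambda>i. map \<psi> es ! i) V"
    proof -
      have "inj_on (\<psi> \<circ> (\<lambda>i. es ! i)) {..<length es}"
        using bij bas by (intro comp_inj_on) (auto simp: bij_betw_def is_basis_def)
      then have "inj_on (\<lambda>i. map \<psi> es ! i) {..<length es}" by (simp add: inj_on_def)
      moreover have "(\<lambda>i. map \<psi> es ! i) ` {..<length es} = \<psi> ` ?E"
        using es(1) by (force simp: set_conv_nth image_iff)
      ultimately show ?thesis using bas by (simp add: is_basis_def)
    qed
    moreover have "es ! i \<in> ?E" if "i < length es" for i using that es(1) nth_mem by blast
    ultimately show "sorted_wrt (>) es \<and> (\<exists>\<psi>s. is_basis_list \<psi>s V \<and> length \<psi>s = length es \<and>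
      (\<forall>i<length es. (\<forall>j<es ! i. (\<psi>s ! i) (z + s * of_nat j) = 0) \<and>
        (\<psi>s ! i) (z + s * of_nat (es ! i)) \<noteq> 0))"
      using es psi by (intro conjI exI[of _ "map \<psi> es"]) auto
  next
    fix es'
    assume "sorted_wrt (>) es' \<and> (\<exists>\<psi>s. is_basis_list \<psi>s V \<and> length \<psi>s = length es' \<and>
      (\<forall>i<length es'. (\<forall>j<es' ! i. (\<psi>s ! i) (z + s * of_nat j) = 0) \<and>
        (\<psi>s ! i) (z + s * of_nat (es' ! i)) \<noteq> 0))"
    then obtain \<psi>s where es': "sorted_wrt (>) es'" and b: "is_basis_list \<psi>s V"
      and len: "length \<psi>s = length es'"
      and ex: "\<And>i. i < length es' \<Longrightarrow> (\<forall>j<es' ! i. (\<psi>s ! i) (z + s * of_nat j) = 0) \<and>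
        (\<psi>s ! i) (z + s * of_nat (es' ! i)) \<noteq> 0" by blast
    have "set es' \<subseteq> ?E"
    proof
      fix e assume "e \<in> set es'"
      then obtain i where i: "i < length es'" "e = es' ! i" by (auto simp: in_set_conv_nth)
      then have "\<psi>s ! i \<in> V" using is_basis_mem[OF b] len by simp
      with ex[OF i(1)] i show "e \<in> ?E" unfolding exponent_set_def by blast
    qed
    moreover have srt: "sorted_wrt (<) (rev es')" using es' by (simp add: sorted_wrt_rev)
    moreover have "card (set es') = card ?E"
      using is_basis_card_eq[OF b bas] len srt distinct_card[of "rev es'"]
      by (simp add: strict_sorted_iff)
    ultimately have "set es' = ?E" using fin by (metis card_subset_eq)
    then have "sorted_list_of_set ?E = rev es'"
      using srt fin by (metis set_rev sorted_list_of_set.idem_if_sorted_distinct strict_sorted_iff)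
    then show "es' = es" by (simp add: es_def)
  qed
qed

lemma discrete_exponents_properties:
  assumes bas: "is_basis I b V"
    and determined: "determined_by_values N s z V"
  shows "sorted_wrt (>) (discrete_exponents (translate s) V z)"
    "set (discrete_exponents (translate s) V z) = exponent_set s V z"
    "length (discrete_exponents (translate s) V z) = card I"
    "exponent_set s V z \<subseteq> {..<N}"
proof -
  let ?E = "exponent_set s V z"
  note sub = is_basis_subspace[OF bas]
  note E = exponent_set_basis(1)[OF sub determined]
  obtain \<psi> where b: "is_basis ?E \<psi> V" using exponent_set_basis(2)[OF sub determined] by blast
  have fin: "finite ?E" using E finite_subset by blast
  note eq = discrete_exponents_eq[OF sub determined]
  show "sorted_wrt (>) (discrete_exponents (translate s) V z)"
    "set (discrete_exponents (translate s) V z) = ?E"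
    "length (discrete_exponents (translate s) V z) = card I" "?E \<subseteq> {..<N}"
    using fin strict_sorted_list_of_set[of ?E] E is_basis_card_eq[OF bas b]
    by (simp_all add: eq sorted_wrt_rev)
qed

section \<open>Quasi-exponentials are determined by finitely many equally spaced values\<close>

section \<open>Zeros of quasi-exponentials\<close>

lemma pcompose_translate:
  fixes q :: "complex poly"
  shows "degree (q \<circ>\<^sub>p [:s, 1:]) = degree q" "lead_coeff (q \<circ>\<^sub>p [:s, 1:]) = lead_coeff q"
  using lead_coeff_comp[of "[:s, 1:]" q] by (simp_all add: degree_pcompose)

text \<open>Invariance gives the value \<open>poly q 0\<close> at the infinitely many points
  \<open>s * of_nat k\<close>, so \<open>q\<close> minus this constant has infinitely many
  roots.\<close>

lemma translate_invariant_poly: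
  fixes q :: "complex poly"
  assumes "q \<circ>\<^sub>p [:s, 1:] = q" "s \<noteq> 0"
  shows "degree q = 0"
proof -
  have q: "poly q (s + x) = poly q x" for x
    using arg_cong[OF assms(1), of "\<lambda>p. poly p x"] by (simp add: poly_pcompose)
  have "poly q (s * of_nat k) = poly q 0" for k
    by (induction k) (simp_all add: algebra_simps q)
  then have "range (\<lambda>k. s * of_nat k) \<subseteq> {x. poly (q - [:poly q 0:]) x = 0}" by auto
  moreover have "inj (\<lambda>k. s * of_nat k)" using assms by (auto simp: inj_def)
  then have "infinite (range (\<lambda>k. s * of_nat k))" using range_inj_infinite by blast
  ultimately have "q - [:poly q 0:] = 0" using poly_roots_finite finite_subset by blast
  then have "q = [:poly q 0:]" by simp
  then show ?thesis by (metis degree_pCons_0)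
qed

text \<open>Induction on the sum of the \<open>p i\<close>: the operator \<open>f \<mapsto> f(x + s) - a k f(x)\<close> lowers \<open>p k\<close>
  by one and preserves the degrees of the other coefficients, at the cost of one zero.\<close>

lemma quasi_polynomial_zero:
  fixes q :: "nat \<Rightarrow> complex poly"
  assumes inj: "inj_on a {..<n}" and s: "s \<noteq> 0" and nz: "\<And>i. i < n \<Longrightarrow> a i \<noteq> 0"
    and "\<And>i. i < n \<Longrightarrow> q i = 0 \<or> degree (q i) < p i"
    and "\<And>j. j < sum p {..<n} \<Longrightarrow> (\<Sum>i<n. a i ^ j * poly (q i) (x + s * of_nat j)) = 0"
  shows "\<forall>i<n. q i = 0"
  using assms(4,5)
proof (induction "sum p {..<n}" arbitrary: p q)
  case 0
  then have "\<forall>i<n. p i = 0" by simp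
  then show ?case using 0 by fastforce
next
  case (Suc N)
  have "\<exists>k<n. p k > 0"
  proof (rule ccontr)
    assume "\<not> ?thesis"
    then have "sum p {..<n} = 0" by simp
    then show False using Suc.hyps by simp
  qed
  then obtain k where k: "k < n" "p k > 0" by blast
  define p' where "p' = p(k := p k - 1)"
  define q' where "q' i = smult (a i) (q i \<circ>\<^sub>p [:s, 1:]) - smult (a k) (q i)" for i
  have "sum p {..<n} = p k + sum p ({..<n} - {k})" using k by (simp add: sum.remove)
  moreover have "sum p' {..<n} = p' k + sum p' ({..<n} - {k})" using k by (simp add: sum.remove)
  moreover have "sum p' ({..<n} - {k}) = sum p ({..<n} - {k})"
    by (rule sum.cong) (auto simp: p'_def)
  ultimately have N: "N = sum p' {..<n}" using Suc.hyps k by (simp add: p'_def)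
  have dle: "degree (q' i) \<le> degree (q i)" for i unfolding q'_def
    by (rule degree_diff_le) (metis pcompose_translate(1) degree_smult_le, rule degree_smult_le)
  have qk: "q' k = smult (a k) (q k \<circ>\<^sub>p [:s, 1:] - q k)"
    by (simp add: q'_def smult_diff_right)
  have deg: "q' i = 0 \<or> degree (q' i) < p' i" if i: "i < n" for i
  proof (cases "i = k")
    case False
    then show ?thesis using Suc.prems(1)[OF i] dle[of i] by (auto simp: p'_def q'_def)
  next
    case True
    show ?thesis
    proof (cases "degree (q k) = 0")
      case True
      then obtain c where "q k = [:c:]" by (auto elim: degree_eq_zeroE)
      then show ?thesis using \<open>i = k\<close> by (simp add: qk pcompose_pCons)
    next
      case False
      \<comment> \<open>Both summands of \<open>q' k\<close> have the same leading term, so the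
        degree drops.\<close>
      have "coeff (q' k) (degree (q k)) = 0"
        using pcompose_translate[of "q k" s] by (simp add: qk)
      then have "degree (q' k) \<noteq> degree (q k) \<or> q' k = 0" by (metis leading_coeff_0_iff)
      then show ?thesis using dle[of k] Suc.prems(1)[OF k(1)] False \<open>i = k\<close> by (auto simp: p'_def)
    qed
  qed
  have "(\<Sum>i<n. a i ^ j * poly (q' i) (x + s * of_nat j)) = 0" if j: "j < sum p' {..<n}" for j
  proof -
    have "(\<Sum>i<n. a i ^ j * poly (q' i) (x + s * of_nat j)) =
      (\<Sum>i<n. a i ^ Suc j * poly (q i) (x + s * of_nat (Suc j))) -
      a k * (\<Sum>i<n. a i ^ j * poly (q i) (x + s * of_nat j))"
      unfolding sum_distrib_left sum_subtractf[symmetric]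
      by (rule sum.cong) (simp_all add: q'_def poly_pcompose algebra_simps)
    then show ?thesis using Suc.prems(2)[of j] Suc.prems(2)[of "Suc j"] j N Suc.hyps by simp
  qed
  from Suc.hyps(1)[OF N deg this] have z: "\<forall>i<n. q' i = 0" by blast
  \<comment> \<open>For \<open>i \<noteq> k\<close> the leading coefficient is multiplied by
    \<open>a i - a k\<close>, which is nonzero, so \<open>q' i = 0\<close> forces
    \<open>q i = 0\<close>.\<close>
  have oth: "q i = 0" if "i < n" "i \<noteq> k" for i
  proof -
    have "(a i - a k) * lead_coeff (q i) = coeff (q' i) (degree (q i))"
      using pcompose_translate[of "q i" s] by (simp add: q'_def algebra_simps)
    then have "(a i - a k) * lead_coeff (q i) = 0" using z that by simp
    moreover have "a i \<noteq> a k" using inj that k by (auto simp: inj_on_def)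
    ultimately show ?thesis by simp
  qed
  have sum0: "(\<Sum>i<n. a i ^ 0 * poly (q i) (x + s * of_nat 0)) = poly (q k) x"
    using k oth by (subst sum.remove[of _ k]) auto
  \<comment> \<open>From \<open>q' k = 0\<close>, the polynomial \<open>q k\<close> is invariant
    under translation, hence constant, and the zero at \<open>j = 0\<close> makes the constant
    vanish.\<close>
  have "q k = 0"
  proof (cases "degree (q k) = 0")
    case True
    then obtain c where "q k = [:c:]" by (auto elim: degree_eq_zeroE)
    then show ?thesis using sum0 Suc.prems(2)[of 0] Suc.hyps(2) by simp
  next
    case False
    then have "q k \<circ>\<^sub>p [:s, 1:] \<noteq> q k"
      using translate_invariant_poly[of "q k" s] s by metis
    then have "a k = 0" using z k qk by simp
    with nz k show ?thesis by simp
  qed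
  then show ?case using oth by blast
qed

section \<open>Linear algebra of a pair of matrices with antitriangular product\<close>

section \<open>Antitriangular products\<close>

lemma sum_bilinear_assoc:
  fixes u :: "'i \<Rightarrow> complex"
  shows "(\<Sum>j\<in>J. (\<Sum>b\<in>B. u b * V b j) * c j) = (\<Sum>b\<in>B. u b * (\<Sum>j\<in>J. V b j * c j))"
  unfolding sum_distrib_left sum_distrib_right mult.assoc by (rule sum.swap)

lemma det_nonzero_if_kernel_trivial:
  fixes V :: "nat \<Rightarrow> nat \<Rightarrow> complex"
  assumes inj: "\<forall>c. (\<forall>b<N. (\<Sum>j<N. V b j * c j) = 0) \<longrightarrow> (\<forall>j<N. c j = 0)"
  shows "det (mat N N (\<lambda>(b, j). V b j)) \<noteq> 0"
proof
  let ?A = "mat N N (\<lambda>(b, j). V b j)"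
  assume "det ?A = 0"
  then obtain v where v: "v \<in> carrier_vec N" "v \<noteq> 0\<^sub>v N" "?A *\<^sub>v v = 0\<^sub>v N"
    using det_0_iff_vec_prod_zero[of ?A N] by auto
  have "(\<Sum>j<N. V b j * v $ j) = 0" if "b < N" for b
  proof -
    have "(?A *\<^sub>v v) $ b = (\<Sum>j<N. V b j * v $ j)"
      using that v(1) by (simp add: scalar_prod_def lessThan_atLeast0)
    then show ?thesis using v(3) that by simp
  qed
  then have "\<forall>j<N. v $ j = 0" using inj by blast
  then have "v = 0\<^sub>v N" using v(1) by auto
  with v(2) show False by simp
qed

text \<open>The determinant is nonzero, so the adjugate divided by it yields a solution.\<close>

lemma surjective_if_kernel_trivial:
  fixes V :: "nat \<Rightarrow> nat \<Rightarrow> complex"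
  assumes inj: "\<forall>c. (\<forall>b<N. (\<Sum>j<N. V b j * c j) = 0) \<longrightarrow> (\<forall>j<N. c j = 0)"
  shows "\<exists>c. \<forall>b<N. (\<Sum>j<N. V b j * c j) = w b"
proof -
  let ?A = "mat N N (\<lambda>(b, j). V b j)"
  have d: "det ?A \<noteq> 0" using inj by (rule det_nonzero_if_kernel_trivial)
  have A: "?A \<in> carrier_mat N N" by simp
  define u where "u = (1 / det ?A) \<cdot>\<^sub>v (adj_mat ?A *\<^sub>v vec N w)"
  have aj: "adj_mat ?A \<in> carrier_mat N N" "?A * adj_mat ?A = det ?A \<cdot>\<^sub>m 1\<^sub>m N"
    using adj_mat[OF A] by auto
  have u: "u \<in> carrier_vec N" using aj by (simp add: u_def)
  have "?A *\<^sub>v u = (1 / det ?A) \<cdot>\<^sub>v ((?A * adj_mat ?A) *\<^sub>v vec N w)"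
  proof -
    have "?A *\<^sub>v (adj_mat ?A *\<^sub>v vec N w) = (?A * adj_mat ?A) *\<^sub>v vec N w"
      by (rule assoc_mult_mat_vec[OF A aj(1), symmetric]) simp
    moreover have "?A *\<^sub>v u = (1 / det ?A) \<cdot>\<^sub>v (?A *\<^sub>v (adj_mat ?A *\<^sub>v vec N w))"
      unfolding u_def using aj(1) by (intro mult_mat_vec[OF A]) simp
    ultimately show ?thesis by (simp only:)
  qed
  also have "\<dots> = vec N w"
  proof -
    have "(det ?A \<cdot>\<^sub>m 1\<^sub>m N) *\<^sub>v vec N w = det ?A \<cdot>\<^sub>v vec N w"
      by (intro eq_vecI) (auto simp: scalar_prod_def if_distrib if_distribR sum.delta cong: if_cong)
    then show ?thesis using d by (simp add: aj smult_smult_assoc)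
  qed
  finally have eq: "?A *\<^sub>v u = vec N w" .
  have "(\<Sum>j<N. V b j * u $ j) = w b" if "b < N" for b
  proof -
    have "(?A *\<^sub>v u) $ b = (\<Sum>j<N. V b j * u $ j)"
      using that u by (simp add: scalar_prod_def lessThan_atLeast0)
    then show ?thesis using eq that by simp
  qed
  then show ?thesis by blast
qed

text \<open>Solving the system with the indicator of \<open>a\<close> on the right and pairing with
  \<open>u\<close> isolates \<open>u a\<close>.\<close>

lemma rows_independent_if_kernel_trivial:
  fixes V :: "nat \<Rightarrow> nat \<Rightarrow> complex"
  assumes inj: "\<forall>c. (\<forall>b<N. (\<Sum>j<N. V b j * c j) = 0) \<longrightarrow> (\<forall>j<N. c j = 0)"
    and u: "\<And>j. j < N \<Longrightarrow> (\<Sum>b<N. u b * V b j) = 0"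
  shows "\<forall>b<N. u b = 0"
proof (intro allI impI)
  fix a assume a: "a < N"
  obtain c where c: "\<forall>b<N. (\<Sum>j<N. V b j * c j) = (if b = a then 1 else 0)"
    using surjective_if_kernel_trivial[OF inj, where w = "\<lambda>b. if b = a then 1 else 0"] by (elim exE)
  have "0 = (\<Sum>j<N. (\<Sum>b<N. u b * V b j) * c j)" using u by simp
  also have "\<dots> = (\<Sum>b<N. u b * (\<Sum>j<N. V b j * c j))"
    by (rule sum_bilinear_assoc)
  also have "\<dots> = (\<Sum>b<N. if b = a then u b else 0)" using c by (intro sum.cong) auto
  finally show "u a = 0" using a by simp
qed

text \<open>Row \<open>N - 1 - j\<close> has zeros to the left of column \<open>j\<close> and a
  nonzero entry in it, so \<open>c j = 0\<close> follows once the later entries are known to be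
  zero. The first \<open>e\<close> rows settle the last \<open>e\<close> entries.\<close>

lemma antitriangular_back_substitution:
  fixes K :: "nat \<Rightarrow> nat \<Rightarrow> complex"
  assumes zero: "\<And>i j. i + j + 1 < N \<Longrightarrow> K i j = 0"
    and one: "\<And>i j. i + j + 1 = N \<Longrightarrow> K i j \<noteq> 0"
    and eq: "\<And>i. i < e \<Longrightarrow> (\<Sum>j<N. K i j * c j) = 0"
    and "e \<le> N"
  shows "j < N \<Longrightarrow> N \<le> j + e \<Longrightarrow> c j = 0"
proof (induction "N - j" arbitrary: j rule: less_induct)
  case less
  define i where "i = N - 1 - j"
  have i: "i < e" "i + j + 1 = N" using less.prems by (auto simp: i_def)
  have "0 = (\<Sum>k<N. K i k * c k)" using eq[OF i(1)] by simp
  also have "\<dots> = (\<Sum>k\<in>{j}. K i k * c k)"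
  proof (rule sum.mono_neutral_right)
    show "\<forall>k\<in>{..<N} - {j}. K i k * c k = 0"
    proof
      fix k assume k: "k \<in> {..<N} - {j}"
      then consider "k < j" | "j < k" by force
      then show "K i k * c k = 0"
      proof cases
        case 1 then show ?thesis using zero[of i k] i by simp
      next
        case 2 then show ?thesis using less.hyps[of k] less.prems k by simp
      qed
    qed
  qed (use less.prems in auto)
  finally show ?case using one[OF i(2)] by simp
qed

text \<open>If \<open>V\<close> kills \<open>c\<close>, so does the product of \<open>G\<close> and
  \<open>V\<close>, and then all \<open>N\<close> rows are available for back substitution.\<close>

lemma antitriangular_product_kernel_trivial:
  fixes G V :: "nat \<Rightarrow> nat \<Rightarrow> complex"
  assumes zero: "\<And>i j. i + j + 1 < N \<Longrightarrow> (\<Sum>b<N. G i b * V b j) = 0"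
    and one: "\<And>i j. i + j + 1 = N \<Longrightarrow> (\<Sum>b<N. G i b * V b j) \<noteq> 0"
  shows "\<forall>c. (\<forall>b<N. (\<Sum>j<N. V b j * c j) = 0) \<longrightarrow> (\<forall>j<N. c j = 0)"
proof (intro allI impI)
  fix c j assume c: "\<forall>b<N. (\<Sum>j<N. V b j * c j) = 0" and "j < N"
  have "(\<Sum>j<N. (\<Sum>b<N. G i b * V b j) * c j) = (\<Sum>b<N. G i b * (\<Sum>j<N. V b j * c j))" for i
    by (rule sum_bilinear_assoc)
  then have "(\<Sum>j<N. (\<Sum>b<N. G i b * V b j) * c j) = 0" for i using c by simp
  then show "c j = 0"
    using antitriangular_back_substitution[OF zero one, where e = N and c = c] \<open>j < N\<close> by auto
qed

text \<open>Here \<open>u\<close> and \<open>w\<close> stand for coordinates of elements of order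
  \<open>k\<close> in the dual and \<open>e\<close> in the space. If the orders were complementary,
  writing \<open>w\<close> as \<open>V\<close> applied to some \<open>c\<close> would leave one
  nonzero term, the one at \<open>k\<close>, in the pairing of \<open>u\<close> with
  \<open>w\<close>.\<close>

lemma orthogonal_orders_not_complementary:
  fixes G V :: "nat \<Rightarrow> nat \<Rightarrow> complex"
  assumes zero: "\<And>i j. i + j + 1 < N \<Longrightarrow> (\<Sum>b<N. G i b * V b j) = 0"
    and one: "\<And>i j. i + j + 1 = N \<Longrightarrow> (\<Sum>b<N. G i b * V b j) \<noteq> 0"
    and orth: "(\<Sum>b<N. u b * w b) = 0"
    and w: "\<And>i. i < e \<Longrightarrow> (\<Sum>b<N. G i b * w b) = 0"
    and we: "(\<Sum>b<N. G e b * w b) \<noteq> 0"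
    and u: "\<And>j. j < k \<Longrightarrow> (\<Sum>b<N. u b * V b j) = 0" and uk: "(\<Sum>b<N. u b * V b k) \<noteq> 0"
  shows "e + k + 1 \<noteq> N"
proof
  assume ek: "e + k + 1 = N"
  have inj: "\<forall>c. (\<forall>b<N. (\<Sum>j<N. V b j * c j) = 0) \<longrightarrow> (\<forall>j<N. c j = 0)"
    by (rule antitriangular_product_kernel_trivial[OF zero one])
  obtain c where c: "\<forall>b<N. (\<Sum>j<N. V b j * c j) = w b"
    using surjective_if_kernel_trivial[OF inj, where w = w] by (elim exE)
  have Gw: "(\<Sum>j<N. (\<Sum>b<N. G i b * V b j) * c j) = (\<Sum>b<N. G i b * w b)" for i
    by (simp add: sum_bilinear_assoc c)
  \<comment> \<open>The first \<open>e\<close> rows kill the last \<open>e\<close> entries of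
    \<open>c\<close>, which are those beyond \<open>k\<close>.\<close>
  have c0: "c j = 0" if "j < N" "k < j" for j
    using antitriangular_back_substitution[OF zero one, where e = e and c = c] Gw w ek that by auto
  \<comment> \<open>Used twice: row \<open>e\<close> of the product gives
    \<open>c k \<noteq> 0\<close>, and the row \<open>u\<close> times \<open>V\<close> turns
    orthogonality into a contradiction.\<close>
  have single: "(\<Sum>j<N. h j * c j) = h k * c k" if "\<And>j. j < k \<Longrightarrow> h j = 0" for h :: "nat \<Rightarrow> complex"
  proof -
    have "(\<Sum>j<N. h j * c j) = (\<Sum>j\<in>{k}. h j * c j)"
    proof (rule sum.mono_neutral_right)
      show "\<forall>j\<in>{..<N} - {k}. h j * c j = 0" using c0 that by (auto simp: neq_iff)
    qed (use ek in auto)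
    then show ?thesis by simp
  qed
  have "c k \<noteq> 0" using single[of "\<lambda>j. \<Sum>b<N. G e b * V b j"] Gw[of e] we zero ek by force
  moreover have "(\<Sum>j<N. (\<Sum>b<N. u b * V b j) * c j) = (\<Sum>b<N. u b * w b)"
    by (simp add: sum_bilinear_assoc c)
  ultimately show False using single[of "\<lambda>j. \<Sum>b<N. u b * V b j"] u uk orth by simp
qed

section \<open>Discrete Wronskians and the pairing of a space with its dual\<close>

section \<open>The dual space\<close>

lemma discrete_wronskian_translate:
  "discrete_wronskian (translate s) gs x =
    det (mat (length gs) (length gs) (\<lambda>(i, j). (gs ! i) (x + s * of_nat j)))"
  by (simp add: discrete_wronskian_def translate_funpow)

text \<open>A kernel vector of the transposed matrix is a combination of \<open>gs\<close> vanishing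
  at \<open>length gs\<close> consecutive points, hence the zero function, hence trivial.\<close>

lemma discrete_wronskian_nonzero:
  assumes bas: "is_basis_list gs V"
    and determined: "determined_by_values (length gs) s x V"
  shows "discrete_wronskian (translate s) gs x \<noteq> 0"
proof -
  let ?N = "length gs"
  have "det (mat ?N ?N (\<lambda>(j, i). (gs ! i) (x + s * of_nat j))) \<noteq> 0"
  proof (rule det_nonzero_if_kernel_trivial, intro allI impI)
    fix c k assume c: "\<forall>j<?N. (\<Sum>i<?N. (gs ! i) (x + s * of_nat j) * c i) = 0"
    have "(\<lambda>x. \<Sum>i<?N. c i * (gs ! i) x) \<in> V"
      using is_basis_mem[OF bas] is_basis_subspace[OF bas] by (intro sum_in_subspace) auto
    then have "(\<lambda>x. \<Sum>i<?N. c i * (gs ! i) x) = 0"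
      using c determined by (auto simp: determined_by_values_def mult.commute)
    then have "(\<Sum>i<?N. c i * (gs ! i) x) = 0" for x by (metis zero_fun_apply)
    from is_basis_family_independent[OF _ bas this] show "k < ?N \<Longrightarrow> c k = 0" by simp
  qed
  moreover have "mat ?N ?N (\<lambda>(i, j). (gs ! i) (x + s * of_nat j)) =
      transpose_mat (mat ?N ?N (\<lambda>(j, i). (gs ! i) (x + s * of_nat j)))"
    by (intro eq_matI) auto
  ultimately show ?thesis unfolding discrete_wronskian_translate
    by (metis det_transpose mat_carrier)
qed

text \<open>The point \<open>y\<close> of the last column is independent of \<open>x\<close>;
  deleting this column and row \<open>b\<close> leaves the Wronskian matrix of the list with
  \<open>gs ! b\<close> removed.\<close>

lemma discrete_wronskian_expansion:
  assumes N: "N = length gs" "N > 0"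
  shows "(\<Sum>b<N. (- 1) ^ (b + (N - 1)) * (gs ! b) y *
      discrete_wronskian (translate s) (take b gs @ drop (Suc b) gs) x) =
    det (mat N N (\<lambda>(i, j). if j = N - 1 then (gs ! i) y else (gs ! i) (x + s * of_nat j)))"
    (is "?lhs = det ?A")
proof -
  have "det ?A = (\<Sum>b<N. ?A $$ (b, N - 1) * cofactor ?A b (N - 1))"
    using N by (intro laplace_expansion_column) auto
  also have "\<dots> = ?lhs"
  proof (rule sum.cong)
    fix b assume b: "b \<in> {..<N}"
    have "mat_delete ?A b (N - 1) = mat (N - 1) (N - 1)
        (\<lambda>(i, j). ((take b gs @ drop (Suc b) gs) ! i) (x + s * of_nat j))"
      using b N by (intro eq_matI) (auto simp: mat_delete_def nth_append min_def)
    moreover have "length (take b gs @ drop (Suc b) gs) = N - 1" using b N by auto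
    ultimately have "cofactor ?A b (N - 1) = (- 1) ^ (b + (N - 1)) *
        discrete_wronskian (translate s) (take b gs @ drop (Suc b) gs) x"
      by (simp add: cofactor_def discrete_wronskian_translate)
    then show "?A $$ (b, N - 1) * cofactor ?A b (N - 1) = (- 1) ^ (b + (N - 1)) * (gs ! b) y *
        discrete_wronskian (translate s) (take b gs @ drop (Suc b) gs) x"
      using b N by simp
  qed simp
  finally show ?thesis ..
qed

text \<open>All conclusions come from one antitriangular product: its trivial kernel gives the first
  two, and orthogonality of coordinates the third.\<close>

lemma dual_space_orders:
  fixes fs hs :: "cfun list"
  assumes N: "N = length (fs @ hs)"
    and bas: "is_basis_list (fs @ hs) V_hat" and fs: "is_basis_list fs V"
    and determined: "\<forall>x. determined_by_values N s x V_hat"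
    and U: "U = cfun.span {translate s (\<lambda>x.
        discrete_wronskian (translate s) (fs @ take a hs @ drop (Suc a) hs) x /
        discrete_wronskian (translate s) (fs @ hs) x) | a. a < length hs}"
  shows "\<exists>v. is_basis {length fs..<N} v U"
    and "determined_by_values N (- s) (z - s) U"
    and "e \<in> exponent_set s V z \<Longrightarrow> k \<in> exponent_set (- s) U (z - s) \<Longrightarrow> e + k + 1 \<noteq> N"
proof -
  define gs where "gs = fs @ hs"
  \<comment> \<open>Defined for every \<open>b < N\<close>, so that the matrix \<open>Y\<close>
    below is square; \<open>U\<close> is spanned by the part with
    \<open>b \<ge> length fs\<close>.\<close>
  define v where "v b = translate s (\<lambda>x.
    discrete_wronskian (translate s) (take b gs @ drop (Suc b) gs) x /
    discrete_wronskian (translate s) gs x)" for b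
  define G where "G i b = (- 1) ^ (b + (N - 1)) * (gs ! b) (z + s * of_nat i)" for i b
  \<comment> \<open>The translation in \<open>v\<close> cancels the offset in \<open>z - s\<close>:
    the quotient is evaluated at \<open>z - s * of_nat j\<close>.\<close>
  define Y where "Y b j = v b (z - s + - s * of_nat j)" for b j
  let ?I = "{length fs..<N}"
  have gsN: "N = length gs" by (simp add: gs_def N)
  have nz: "discrete_wronskian (translate s) gs x \<noteq> 0" for x
    using discrete_wronskian_nonzero[OF bas, of s x] determined N by (simp add: gs_def)
  have GY: "(\<Sum>b<N. G i b * Y b j) =
      det (mat N N (\<lambda>(i', j'). if j' = N - 1 then (gs ! i') (z + s * of_nat i)
        else (gs ! i') (z - s * of_nat j + s * of_nat j'))) /
      discrete_wronskian (translate s) gs (z - s * of_nat j)" if "N > 0" for i j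
    unfolding discrete_wronskian_expansion[OF gsN that, symmetric] sum_divide_distrib
    by (rule sum.cong) (simp_all add: G_def Y_def v_def translate_def)
  have zero: "(\<Sum>b<N. G i b * Y b j) = 0" if ij: "i + j + 1 < N" for i j
  proof -
    let ?A = "mat N N (\<lambda>(i', j'). if j' = N - 1 then (gs ! i') (z + s * of_nat i)
        else (gs ! i') (z - s * of_nat j + s * of_nat j'))"
    \<comment> \<open>Since \<open>z - s * of_nat j + s * of_nat (i + j) = z + s * of_nat i\<close>,
      the last column repeats column \<open>i + j\<close>.\<close>
    have "col ?A (i + j) = col ?A (N - 1)"
      using ij by (intro eq_vecI) (auto simp: algebra_simps)
    then have "det ?A = 0" using ij by (intro det_identical_columns[of _ N "i + j" "N - 1"]) auto
    then show ?thesis using GY ij by simp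
  qed
  have one: "(\<Sum>b<N. G i b * Y b j) \<noteq> 0" if ij: "i + j + 1 = N" for i j
  proof -
    let ?A = "mat N N (\<lambda>(i', j'). if j' = N - 1 then (gs ! i') (z + s * of_nat i)
        else (gs ! i') (z - s * of_nat j + s * of_nat j'))"
    have "N - 1 = i + j" "N > 0" using ij by simp_all
    \<comment> \<open>Now the last column is the regular one, so numerator and denominator
      agree.\<close>
    then have "?A = mat N N (\<lambda>(i', j'). (gs ! i') (z - s * of_nat j + s * of_nat j'))"
      by (intro eq_matI) (auto simp: algebra_simps)
    then have A: "det ?A = discrete_wronskian (translate s) gs (z - s * of_nat j)"
      by (simp only: discrete_wronskian_translate gsN)
    show ?thesis unfolding GY[OF \<open>N > 0\<close>] A using nz by simp
  qed
  have ker: "\<forall>c. (\<forall>b<N. (\<Sum>j<N. Y b j * c j) = 0) \<longrightarrow> (\<forall>j<N. c j = 0)"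
    by (rule antitriangular_product_kernel_trivial[OF zero one])
  have "{translate s (\<lambda>x.
        discrete_wronskian (translate s) (fs @ take a hs @ drop (Suc a) hs) x /
        discrete_wronskian (translate s) (fs @ hs) x) | a. a < length hs} =
      (\<lambda>a. v (length fs + a)) ` {..<length hs}"
    by (auto simp: v_def gs_def)
  also have "\<dots> = v ` ?I"
    unfolding N length_append image_comp[symmetric, of v "\<lambda>a. length fs + a", unfolded comp_def]
    using image_add_atLeastLessThan[of "length fs" 0 "length hs"]
    by (simp add: lessThan_atLeast0 add.commute)
  finally have U': "U = cfun.span (v ` ?I)" using U by simp
  have ext: "(\<Sum>b<N. (if b < length fs then 0 else d b) * Y b j) =
      (\<Sum>b\<in>?I. d b * v b (z - s + - s * of_nat j))" for d j
    by (rule sum.mono_neutral_cong_right) (auto simp: Y_def)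
  \<comment> \<open>A relation on the first \<open>N\<close> points is a row annihilating
    \<open>Y\<close>. This yields both the independence of \<open>v\<close> and the determination of
    \<open>U\<close> by values.\<close>
  have row0: "\<forall>b\<in>?I. d b = 0"
    if d0: "\<And>j. j < N \<Longrightarrow> (\<Sum>b\<in>?I. d b * v b (z - s + - s * of_nat j)) = 0" for d
  proof -
    have "(\<Sum>b<N. (if b < length fs then 0 else d b) * Y b j) = 0" if "j < N" for j
      by (simp only: ext d0[OF that])
    from rows_independent_if_kernel_trivial[OF ker this] show ?thesis by force
  qed
  have vb: "is_basis ?I v U" unfolding U'
    by (rule is_basis_familyI, simp, rule row0, blast)
  then show "\<exists>v. is_basis {length fs..<N} v U" by blast
  show "determined_by_values N (- s) (z - s) U"
    unfolding determined_by_values_def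
  proof (intro ballI impI)
    fix u assume u: "u \<in> U" "\<forall>j<N. u (z - s + - s * of_nat j) = 0"
    obtain d where d: "\<And>x. u x = (\<Sum>b\<in>?I. d b * v b x)"
      using is_basis_expand[OF _ vb u(1)] by auto
    have "\<forall>b\<in>?I. d b = 0"
    proof (rule row0)
      fix j assume "j < N"
      with u(2) have "u (z - s + - s * of_nat j) = 0" by blast
      then show "(\<Sum>b\<in>?I. d b * v b (z - s + - s * of_nat j)) = 0" by (simp only: d)
    qed
    then show "u = 0" by (simp add: fun_eq_iff d)
  qed
  show "e + k + 1 \<noteq> N" if e: "e \<in> exponent_set s V z" and k: "k \<in> exponent_set (- s) U (z - s)"
  proof -
    obtain w where w: "w \<in> V" "\<forall>j<e. w (z + s * of_nat j) = 0" "w (z + s * of_nat e) \<noteq> 0"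
      using e by (auto simp: exponent_set_def)
    obtain u where u: "u \<in> U" "\<forall>j<k. u (z - s + - s * of_nat j) = 0"
        "u (z - s + - s * of_nat k) \<noteq> 0"
      using k unfolding exponent_set_def by blast
    obtain c where c: "\<And>x. w x = (\<Sum>b<length fs. c b * (fs ! b) x)"
      using is_basis_expand[OF _ fs w(1)] by auto
    obtain d where d: "\<And>x. u x = (\<Sum>b\<in>?I. d b * v b x)"
      using is_basis_expand[OF _ vb u(1)] by auto
    \<comment> \<open>The sign compensates the one in \<open>G\<close>. The supports of
      \<open>?w\<close> and \<open>?u\<close> are disjoint, which is the orthogonality of the two
      spaces.\<close>
    let ?w = "\<lambda>b. if b < length fs then (- 1) ^ (b + (N - 1)) * c b else 0"
    let ?u = "\<lambda>b. if b < length fs then 0 else d b"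
    have uY: "(\<Sum>b<N. ?u b * Y b j) = u (z - s + - s * of_nat j)" for j
      by (simp only: ext d)
    have Gw: "(\<Sum>b<N. G i b * ?w b) = w (z + s * of_nat i)" for i
    proof -
      have "(\<Sum>b<N. G i b * ?w b) = (\<Sum>b<length fs. c b * (fs ! b) (z + s * of_nat i))"
        by (rule sum.mono_neutral_cong_right)
          (auto simp: G_def N gs_def nth_append simp flip: power_add mult.assoc)
      then show ?thesis by (simp add: c)
    qed
    have orth: "(\<Sum>b<N. ?u b * ?w b) = 0" by (rule sum.neutral) simp
    show ?thesis
      by (rule orthogonal_orders_not_complementary[OF zero one orth]) (use w u uY Gw in simp_all)
  qed
qed

section \<open>Conjugation of partitions as reflection and complement of positions\<close>

section \<open>Conjugate partitions\<close>

text \<open>Among \<open>K + M\<close> positions, \<open>es\<close> and the reflected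
  \<open>fs\<close> are complementary. The number of entries of \<open>es\<close> above the
  reflection of \<open>fs ! a\<close> is \<open>eta a\<close>, and it is also the number of parts of
  \<open>lam\<close> exceeding \<open>a\<close>.\<close>

lemma conj_partition_exponents:
  assumes es: "sorted_wrt (>) es" "set es \<subseteq> {..<K + M}" "length es = K"
    and fs: "sorted_wrt (>) fs" "set fs \<subseteq> {..<K + M}" "length fs = M"
    and disj: "\<And>e f. e \<in> set es \<Longrightarrow> f \<in> set fs \<Longrightarrow> e + f + 1 \<noteq> K + M"
    and lam: "is_exponent_partition K es lam" and eta: "is_exponent_partition M fs eta"
  shows "eta = conj_partition lam"
proof
  fix a
  have anti: "i \<le> j \<Longrightarrow> lam j \<le> lam i" "i \<le> j \<Longrightarrow> eta j \<le> eta i" for i j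
    using lam eta by (auto simp: is_exponent_partition_def is_partition_def antimono_def)
  have lam0: "lam i = 0" if "i \<ge> K" for i
    using lam anti(1)[OF that] by (simp add: is_exponent_partition_def)
  have lamE: "es ! i + i + 1 = K + lam i" if "i < K" for i
    using lam that by (force simp: is_exponent_partition_def)
  have etaE: "fs ! i + i + 1 = M + eta i" if "i < M" for i
    using eta that by (force simp: is_exponent_partition_def)
  have "{j. lam j \<ge> a + 1} = {..<eta a}"
  proof (cases "a < M")
    \<comment> \<open>Both sides are empty: \<open>eta a = 0\<close> by monotonicity, and no part of
      \<open>lam\<close> exceeds \<open>M\<close> because the entries of \<open>es\<close> stay
      below \<open>K + M\<close>.\<close>
    case False
    then have "eta a = 0" using eta anti(2)[of M a] by (simp add: is_exponent_partition_def)
    moreover have "lam j \<le> a" for j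
    proof (cases "j < K")
      case True
      then have "es ! j < K + M" "es ! 0 < K + M" using es(2,3) by (metis lessThan_iff nth_mem subsetD less_nat_zero_code neq0_conv)+
      then have "lam 0 \<le> M" using lamE[of 0] True by linarith
      then show ?thesis using anti(1)[of 0 j] False by linarith
    qed (simp add: lam0)
    ultimately show ?thesis by (auto simp: not_less_eq_eq)
  next
    case True
    \<comment> \<open>The gap of \<open>es\<close> that corresponds to
      \<open>fs ! a\<close>.\<close>
    define c where "c = K + M - 1 - fs ! a"
    have fa: "fs ! a < K + M" using fs(2,3) True by (metis lessThan_iff nth_mem subsetD)
    have injf: "inj_on (\<lambda>f. K + M - 1 - f) (set fs)"
    proof (rule inj_onI)
      fix x y assume "x \<in> set fs" "y \<in> set fs" and eq: "K + M - 1 - x = K + M - 1 - y"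
      then have "x < K + M" "y < K + M" using fs(2) by auto
      then show "x = y" using eq by linarith
    qed
    \<comment> \<open>\<open>disj\<close> gives the inclusion, and both sides have \<open>K\<close>
      elements.\<close>
    have compl: "set es = {..<K + M} - (\<lambda>f. K + M - 1 - f) ` set fs"
    proof (rule card_subset_eq)
      show "set es \<subseteq> {..<K + M} - (\<lambda>f. K + M - 1 - f) ` set fs"
      proof
        fix e assume e: "e \<in> set es"
        then have "e < K + M" using es by auto
        moreover have "e \<noteq> K + M - 1 - f" if "f \<in> set fs" for f
          using disj[OF e that] that fs(2) by force
        ultimately show "e \<in> {..<K + M} - (\<lambda>f. K + M - 1 - f) ` set fs" by blast
      qed
      have "distinct es" "distinct fs" using es(1) fs(1)
        by (metis distinct_rev sorted_wrt_rev strict_sorted_iff)+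
      then have "card ((\<lambda>f. K + M - 1 - f) ` set fs) = M" "card (set es) = K"
        using es fs injf by (simp_all add: card_image distinct_card)
      moreover have "(\<lambda>f. K + M - 1 - f) ` set fs \<subseteq> {..<K + M}" using fa by auto
      ultimately show "card (set es) = card ({..<K + M} - (\<lambda>f. K + M - 1 - f) ` set fs)"
        by (simp add: card_Diff_subset)
    qed simp
    have mono_f: "i < j \<Longrightarrow> j < M \<Longrightarrow> fs ! j < fs ! i" for i j
      using fs by (simp add: sorted_wrt_iff_nth_less)
    have mono_e: "i < j \<Longrightarrow> j < K \<Longrightarrow> es ! j < es ! i" for i j
      using es by (simp add: sorted_wrt_iff_nth_less)
    have "{f \<in> set fs. f < fs ! a} = (!) fs ` {a<..<M}"
    proof (intro equalityI subsetI)
      fix f assume "f \<in> {f \<in> set fs. f < fs ! a}"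
      then obtain i where i: "f = fs ! i" "i < M" "fs ! i < fs ! a" by (auto simp: in_set_conv_nth fs(3))
      then have "a < i" using mono_f[of i a] True by (metis less_irrefl linorder_neqE_nat order_less_trans)
      then show "f \<in> (!) fs ` {a<..<M}" using i by auto
    next
      fix f assume "f \<in> (!) fs ` {a<..<M}"
      then show "f \<in> {f \<in> set fs. f < fs ! a}" using mono_f[of a] fs(3) by auto
    qed
    moreover have "inj_on ((!) fs) {a<..<M}" using mono_f by (intro linorder_inj_onI') fastforce
    ultimately have "card {f \<in> set fs. f < fs ! a} = M - Suc a" by (simp add: card_image)
    \<comment> \<open>There are \<open>fs ! a\<close> positions above \<open>c\<close>; taking away
      the \<open>M - Suc a\<close> reflections of smaller entries of \<open>fs\<close> leaves
      \<open>eta a\<close> entries of \<open>es\<close>.\<close>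
    moreover have "{c<..<K + M} =
      {e \<in> set es. c < e} \<union> (\<lambda>f. K + M - 1 - f) ` {f \<in> set fs. f < fs ! a}" (is "_ = ?A \<union> ?B")
    proof -
      have "e \<in> ?A \<union> ?B" if "c < e" "e < K + M" for e
      proof (cases "e \<in> set es")
        case False
        then have "e \<in> (\<lambda>f. K + M - 1 - f) ` set fs" using that unfolding compl by blast
        then obtain f where f: "f \<in> set fs" "e = K + M - 1 - f" by blast
        then have "f < fs ! a" using that by (simp add: c_def)
        with f show ?thesis by blast
      qed (use that in simp)
      moreover have "c < K + M - 1 - f" if "f < fs ! a" for f using that fa by (simp add: c_def)
      moreover have "e < K + M" if "e \<in> set es" for e using that es(2) by auto
      ultimately show ?thesis using fa by (intro equalityI subsetI) auto
    qed
    moreover have "?A \<inter> ?B = {}" unfolding compl by blast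
    moreover have "card ?B = card {f \<in> set fs. f < fs ! a}"
      using injf by (intro card_image) (auto elim: inj_on_subset)
    moreover have "card (?A \<union> ?B) = card ?A + card ?B" if "?A \<inter> ?B = {}"
      using that by (intro card_Un_disjoint) auto
    ultimately have "K + M - Suc c = card ?A + (M - Suc a)"
      by (metis card_greaterThanLessThan)
    then have cnt: "card {e \<in> set es. c < e} = eta a" using etaE[OF True] fa True by (simp add: c_def)
    define J where "J = {i. i < K \<and> c < es ! i}"
    have "{e \<in> set es. c < e} = (!) es ` J" using es(3) by (auto simp: J_def in_set_conv_nth)
    moreover have "inj_on ((!) es) J" using mono_e by (intro linorder_inj_onI') (fastforce simp: J_def)+
    ultimately have cJ: "card J = eta a" using cnt by (simp add: card_image)
    \<comment> \<open>the entries of \<open>es\<close> above the gap \<open>c\<close> form an initial segment of length \<open>eta a\<close>\<close>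
    have down: "i \<in> J" if "j \<in> J" "i \<le> j" for i j
      using that mono_e[of i j] by (cases "i = j") (auto simp: J_def)
    have fJ: "finite J" by (simp add: J_def)
    have J: "i \<in> J \<longleftrightarrow> i < eta a" for i
    proof
      assume "i \<in> J"
      then have "{..i} \<subseteq> J" using down by auto
      then show "i < eta a" using card_mono[OF fJ, of "{..i}"] cJ by simp
    next
      assume i: "i < eta a"
      show "i \<in> J"
      proof (rule ccontr)
        assume "i \<notin> J"
        then have "J \<subseteq> {..<i}" using down by (metis lessThan_iff linorder_not_le subsetI)
        then have "card J \<le> i" using card_mono[of "{..<i}" J] by simp
        then show False using i cJ by simp
      qed
    qed
    have cn: "c \<notin> set es" using True fs(3) by (auto simp: compl c_def)
    \<comment> \<open>That is, \<open>c + eta a = K + a\<close>. With \<open>lamE\<close>, comparing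
      \<open>es ! j\<close> to \<open>c\<close> at \<open>j = eta a - 1\<close> and
      \<open>j = eta a\<close> decides whether \<open>lam j\<close> exceeds
      \<open>a\<close>.\<close>
    have cc: "c + M + eta a = K + M + a" using etaE[OF True] fa by (simp add: c_def)
    show ?thesis
    proof (intro equalityI subsetI)
      fix j assume j: "j \<in> {..<eta a}"
      then have "eta a - 1 \<in> J" using J by auto
      then have "a < lam (eta a - 1)" using lamE[of "eta a - 1"] cc j by (auto simp: J_def)
      moreover have "lam (eta a - 1) \<le> lam j" using j by (intro anti) auto
      ultimately show "j \<in> {j. lam j \<ge> a + 1}" by simp
    next
      fix j assume "j \<in> {j. lam j \<ge> a + 1}"
      then have j: "a < lam j" by simp
      show "j \<in> {..<eta a}"
      proof (rule ccontr)
        assume "j \<notin> {..<eta a}"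
        then have l: "a < lam (eta a)" using anti(1)[of "eta a" j] j by auto
        then have k: "eta a < K" using lam0 by (metis less_nat_zero_code linorder_not_le)
        then have "es ! eta a \<le> c" using J[of "eta a"] by (simp add: J_def)
        moreover have "es ! eta a \<noteq> c" using cn k es(3) nth_mem by blast
        ultimately show False using lamE[OF k] cc l by simp
      qed
    qed
  qed
  then show "eta a = conj_partition lam a" by (simp add: conj_partition_def)
qed

section \<open>Both halves of the theorem from one statement with step \<open>s\<close>\<close>

section \<open>Transposition of exponents\<close>

lemma quasi_exponential_sum:
  fixes p :: "nat \<Rightarrow> nat" and c :: "nat \<times> nat \<Rightarrow> complex"
  defines "q \<equiv> \<lambda>i. \<Sum>k<p i. monom (c (i, k)) k"
  shows "(\<Sum>t\<in>(SIGMA i:{..<n}. {..<p i}). c t * (case t of (i, k) \<Rightarrow> exp (x * \<beta> i) * x ^ k)) =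
      (\<Sum>i<n. exp (x * \<beta> i) * poly (q i) x)"
    and "k < p i \<Longrightarrow> coeff (q i) k = c (i, k)"
    and "q i = 0 \<or> degree (q i) < p i"
proof -
  have "(\<Sum>t\<in>(SIGMA i:{..<n}. {..<p i}). c t * (case t of (i, k) \<Rightarrow> exp (x * \<beta> i) * x ^ k)) =
      (\<Sum>i<n. \<Sum>k<p i. c (i, k) * (exp (x * \<beta> i) * x ^ k))"
    by (subst sum.Sigma) (auto intro: sum.cong)
  also have "\<dots> = (\<Sum>i<n. exp (x * \<beta> i) * poly (q i) x)"
    by (simp add: q_def poly_sum poly_monom sum_distrib_left algebra_simps)
  finally show "(\<Sum>t\<in>(SIGMA i:{..<n}. {..<p i}).
      c t * (case t of (i, k) \<Rightarrow> exp (x * \<beta> i) * x ^ k)) = (\<Sum>i<n. exp (x * \<beta> i) * poly (q i) x)" .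
  have co: "coeff (q i) k = (if k < p i then c (i, k) else 0)" for k
    by (simp add: q_def coeff_sum)
  then show "k < p i \<Longrightarrow> coeff (q i) k = c (i, k)" by simp
  show "q i = 0 \<or> degree (q i) < p i" using co by (metis leading_coeff_0_iff)
qed

text \<open>On the progression from \<open>y\<close> the exponential is
  \<open>exp (y * \<beta> i)\<close> times the \<open>j\<close>-th power of
  \<open>exp (s * \<beta> i)\<close>. The constant is absorbed in the polynomial, and
  \<open>quasi_polynomial_zero\<close> applies with the bases
  \<open>exp (s * \<beta> i)\<close>.\<close>

lemma quasi_exponential_vanishing:
  fixes c :: "nat \<times> nat \<Rightarrow> complex"
  assumes s: "s \<noteq> 0" and inj: "inj_on (\<lambda>i. exp (s * \<beta> i)) {..<n}"
    and vanish: "\<And>j. j < sum p {..<n} \<Longrightarrow> (\<Sum>t\<in>(SIGMA i:{..<n}. {..<p i}).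
      c t * (case t of (i, k) \<Rightarrow> exp ((y + s * of_nat j) * \<beta> i) * (y + s * of_nat j) ^ k)) = 0"
  shows "\<forall>t\<in>(SIGMA i:{..<n}. {..<p i}). c t = 0"
proof -
  define q where "q i = (\<Sum>k<p i. monom (c (i, k)) k)" for i
  note q = quasi_exponential_sum[where c = c and p = p, folded q_def]
  have "\<forall>i<n. smult (exp (y * \<beta> i)) (q i) = 0"
  proof (rule quasi_polynomial_zero[OF inj s, where p = p and x = y])
    fix j assume j: "j < sum p {..<n}"
    have "(\<Sum>i<n. exp (s * \<beta> i) ^ j * poly (smult (exp (y * \<beta> i)) (q i)) (y + s * of_nat j)) =
      (\<Sum>i<n. exp ((y + s * of_nat j) * \<beta> i) * poly (q i) (y + s * of_nat j))"
    proof (rule sum.cong)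
      fix i
      have "exp ((y + s * of_nat j) * \<beta> i) = exp (y * \<beta> i) * exp (of_nat j * (s * \<beta> i))"
        unfolding exp_add[symmetric] by (rule arg_cong[where f = exp]) (simp add: algebra_simps)
      then have "exp ((y + s * of_nat j) * \<beta> i) = exp (y * \<beta> i) * exp (s * \<beta> i) ^ j"
        by (simp only: exp_of_nat_mult)
      then show "exp (s * \<beta> i) ^ j * poly (smult (exp (y * \<beta> i)) (q i)) (y + s * of_nat j) =
          exp ((y + s * of_nat j) * \<beta> i) * poly (q i) (y + s * of_nat j)"
        by (simp only: poly_smult mult.assoc mult.left_commute)
    qed simp
    then show "(\<Sum>i<n. exp (s * \<beta> i) ^ j *
        poly (smult (exp (y * \<beta> i)) (q i)) (y + s * of_nat j)) = 0"
      using vanish[OF j] q(1) by simp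
  qed (use q(3) in auto)
  then have "q i = 0" if "i < n" for i using that by simp
  then show ?thesis using q(2) by fastforce
qed

text \<open>The common form of both halves: \<open>s = 1\<close> with \<beta> the logarithms, and
  \<open>s = - 1\<close> with their negatives.\<close>

lemma exponent_partition_of_dual_space:
  fixes \<beta> :: "nat \<Rightarrow> complex"
  assumes s: "s \<noteq> 0" and inj: "inj_on (\<lambda>i. exp (s * \<beta> i)) {..<n}"
    and V_hat: "V_hat = cfun.span {(\<lambda>x. exp (x * \<beta> i) * x ^ k) | i k. i < n \<and> k < p i}"
    and p: "sum p {..<n} = K + M"
    and V: "is_basis I b V" "card I = K"
    and dual: "is_dual_space (translate s) V_hat V U"
    and lam: "is_exponent_partition K (discrete_exponents (translate s) V z) lam"
    and eta: "is_exponent_partition M (discrete_exponents (translate (- s)) U (z - s)) eta"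
  shows "eta = conj_partition lam"
proof -
  let ?J = "SIGMA i:{..<n}. {..<p i}"
  define g :: "nat \<times> nat \<Rightarrow> cfun" where "g = (\<lambda>(i, k) x. exp (x * \<beta> i) * x ^ k)"
  have g: "g t x = (case t of (i, k) \<Rightarrow> exp (x * \<beta> i) * x ^ k)" for t x
    by (simp add: g_def split: prod.split)
  have "V_hat = cfun.span (g ` ?J)"
    unfolding V_hat by (rule arg_cong[where f = cfun.span]) (force simp: g_def)
  moreover have "is_basis ?J g (cfun.span (g ` ?J))"
  proof (rule is_basis_familyI)
    fix c assume c: "\<And>x. (\<Sum>t\<in>?J. c t * g t x) = 0"
    show "\<forall>t\<in>?J. c t = 0"
      by (rule quasi_exponential_vanishing[OF s inj, where y = 0]) (rule c[unfolded g])
  qed simp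
  ultimately have bas: "is_basis ?J g V_hat" by simp
  have card: "card ?J = K + M" using p by simp
  have determined: "\<forall>x. determined_by_values (K + M) s x V_hat"
    unfolding determined_by_values_def
  proof (intro allI ballI impI)
    fix x f assume f: "f \<in> V_hat" "\<forall>j<K + M. f (x + s * of_nat j) = 0"
    obtain c where c: "\<And>x. f x = (\<Sum>t\<in>?J. c t * g t x)"
      using is_basis_expand[OF _ bas f(1)] by auto
    have c0: "\<forall>t\<in>?J. c t = 0"
      by (rule quasi_exponential_vanishing[OF s inj, where y = x])
        (use f(2)[unfolded c g] p in simp)
    have "f x = 0" for x unfolding c by (rule sum.neutral) (use c0 in simp)
    then show "f = 0" by (simp add: fun_eq_iff)
  qed
  obtain fs hs where fs: "is_basis_list fs V" and fhs: "is_basis_list (fs @ hs) V_hat"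
    and U: "U = cfun.span {translate s (\<lambda>x.
        discrete_wronskian (translate s) (fs @ take a hs @ drop (Suc a) hs) x /
        discrete_wronskian (translate s) (fs @ hs) x) | a. a < length hs}"
    using dual unfolding is_dual_space_def by blast
  have lf: "length fs = K" using is_basis_card_eq[OF fs V(1)] V(2) by simp
  have N: "K + M = length (fs @ hs)" using is_basis_card_eq[OF fhs bas] card by simp
  have "V \<subseteq> V_hat"
  proof -
    have "fs ! i \<in> V_hat" if "i < length fs" for i
      using is_basis_mem[OF fhs, of i] that by (simp add: nth_append)
    then show ?thesis using fs is_basis_subspace[OF fhs]
      unfolding is_basis_def by (metis (no_types, lifting) cfun.span_minimal image_subsetI lessThan_iff)
  qed
  then have "determined_by_values (K + M) s z V"
    using determined unfolding determined_by_values_def by blast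
  note eV = discrete_exponents_properties[OF V(1) this]
  note dso = dual_space_orders[OF N fhs fs determined U]
  obtain v where v: "is_basis {length fs..<K + M} v U" using dso(1) by blast
  note eU = discrete_exponents_properties[OF v dso(2)]
  show ?thesis
  proof (rule conj_partition_exponents[OF _ _ _ _ _ _ _ lam eta])
    show "length (discrete_exponents (translate s) V z) = K" using eV(3) V(2) by simp
    show "length (discrete_exponents (translate (- s)) U (z - s)) = M" using eU(3) lf by simp
    fix e k
    assume "e \<in> set (discrete_exponents (translate s) V z)"
      "k \<in> set (discrete_exponents (translate (- s)) U (z - s))"
    then show "e + k + 1 \<noteq> K + M" unfolding eV(2) eU(2) by (rule dso(3))
  qed (use eV(1,2,4) eU(1,2,4) in simp_all)
qed

lemma quasi_exp_spaces_basis: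
  assumes "V \<in> quasi_exp_spaces n \<beta> r d"
  obtains I :: "(nat \<times> nat) set" and b where "is_basis I b V" "card I = (\<Sum>i<n. r i)"
  using assms unfolding quasi_exp_spaces_def by (auto simp: card_SigmaI intro: that)

theorem corollary2p13:
  fixes L :: "complex \<Rightarrow> complex" and n :: nat and \<alpha> :: "nat \<Rightarrow> complex"
    and \<mu> :: "nat \<Rightarrow> nat \<Rightarrow> nat" and z :: complex and M M' :: nat
  assumes log_branch: "\<And>w. w \<noteq> 0 \<Longrightarrow> exp (L w) = w"
    and alpha_distinct: "inj_on \<alpha> {..<n}"
    and alpha_nonzero: "\<And>i. i < n \<Longrightarrow> \<alpha> i \<noteq> 0"
    and mu_partition: "\<And>i. i < n \<Longrightarrow> is_partition (\<mu> i)"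
    and mu_nonzero: "\<And>i. i < n \<Longrightarrow> \<mu> i \<noteq> (\<lambda>_. 0)"
    and M'_eq: "M' = (\<Sum>i<n. conj_partition (\<mu> i) 0)"
    and M_eq: "M = (\<Sum>i<n. \<mu> i 0)"
  shows "(\<forall>W QW lam eta.
            W \<in> E_space L n \<alpha> \<mu> \<longrightarrow> is_Q L n \<alpha> \<mu> W QW \<longrightarrow>
            is_exponent_partition M' (discrete_exponents shift W z) lam \<longrightarrow>
            is_exponent_partition M (discrete_exponents shift_inv QW (z - 1)) eta \<longrightarrow>
            eta = conj_partition lam) \<and>
         (\<forall>W QW lam eta.
            W \<in> E_space_inv L n \<alpha> \<mu> \<longrightarrow> is_Q_inv L n \<alpha> \<mu> W QW \<longrightarrow>
            is_exponent_partition M (discrete_exponents shift_inv W (z - 1)) lam \<longrightarrow>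
            is_exponent_partition M' (discrete_exponents shift QW z) eta \<longrightarrow>
            eta = conj_partition lam)"
proof -
  let ?p = "\<lambda>i. \<mu> i 0 + conj_partition (\<mu> i) 0"
  have p: "sum ?p {..<n} = M' + M" "sum ?p {..<n} = M + M'"
    by (simp_all add: sum.distrib M'_eq M_eq)
  \<comment> \<open>In the second case the two signs cancel, so the bases are
    \<open>\<alpha> i\<close> both times.\<close>
  have inj: "inj_on (\<lambda>i. exp (1 * L (\<alpha> i))) {..<n}"
      "inj_on (\<lambda>i. exp (- 1 * - L (\<alpha> i))) {..<n}"
    using alpha_distinct log_branch alpha_nonzero by (simp_all add: inj_on_def)
  show ?thesis
  proof (intro conjI allI impI)
    fix W QW lam eta
    assume W: "W \<in> E_space L n \<alpha> \<mu>" and Q: "is_Q L n \<alpha> \<mu> W QW"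
      and lam: "is_exponent_partition M' (discrete_exponents shift W z) lam"
      and eta: "is_exponent_partition M (discrete_exponents shift_inv QW (z - 1)) eta"
    obtain I :: "(nat \<times> nat) set" and b where b: "is_basis I b W" "card I = M'"
      using W quasi_exp_spaces_basis unfolding E_space_def M'_eq by metis
    show "eta = conj_partition lam"
      using exponent_partition_of_dual_space[OF _ inj(1) hat_space_def p(1) b] Q lam eta
      by (simp add: is_Q_def shift_eq_translate)
  next
    fix W QW lam eta
    assume W: "W \<in> E_space_inv L n \<alpha> \<mu>" and Q: "is_Q_inv L n \<alpha> \<mu> W QW"
      and lam: "is_exponent_partition M (discrete_exponents shift_inv W (z - 1)) lam"
      and eta: "is_exponent_partition M' (discrete_exponents shift QW z) eta"
    obtain I :: "(nat \<times> nat) set" and b where b: "is_basis I b W" "card I = M"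
      using W quasi_exp_spaces_basis unfolding E_space_inv_def M_eq by metis
    \<comment> \<open>With \<open>s = - 1\<close> and base point \<open>z - 1\<close>, the dual is
      examined at \<open>z - 1 - (- 1) = z\<close>.\<close>
    show "eta = conj_partition lam"
      using exponent_partition_of_dual_space[OF _ inj(2) hat_space_def p(2) b, where z = "z - 1"]
        Q lam eta
      by (simp add: is_Q_inv_def shift_eq_translate)
  qed
qed

end
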